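(* For every integer $n\ge0$ let $$P_n=P_n(q)=\sum_{j\ge0}\sum_{k\ge0}\sum_{l\ge0}q^{j^2+j+k(k+1)/2+l}\begin{bmatrix} j\\ k\end{bmatrix}_{q}\begin{bmatrix} j+l\\ l\end{bmatrix}_{q^2}\begin{bmatrix} n-j-k-2l\\ j\end{bmatrix}_{q}.$$ Then $$P_n=\sum_{j=-\infty}^\infty(-1)^jq^{3j^2+2j}\,T_1(n+1,3j+1;\sqrt q),$$ and $P_0=P_1=1$, $P_2=q^2+q+1$, and $P_n=P_{n-1}+(q+q^n)P_{n-2}+(q^n-q)P_{n-3}$ for $n\ge3$.
   Context: $q$ is an indeterminate with a formal square root $\sqrt q$. $(a;p)_n=\prod_{i=0}^{n-1}(1-ap^i)$. The Gaussian polynomial in base $p$ is $\begin{bmatrix} A\\ B\end{bmatrix}_{p}=\frac{(p;p)_A}{(p;p)_B(p;p)_{A-B}}$ if $0\le B\le A$, and $0$ otherwise. For integers $L\ge0$ and $A$, $$T_1(L,A;q)=\sum_{r=0}^L(-q)^r\begin{bmatrix} L\\ r\end{bmatrix}_{q^2}\begin{bmatrix} 2L-2r\\ L-A-r\end{bmatrix}_{q},$$ and $T_1(L,A;\sqrt q)$ is obtained by replacing $q$ by $\sqrt q$. All sums have only finitely many nonzero terms. *)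

theory Defs
  imports
    "HOL-Computational_Algebra.Computational_Algebra"
    "HOL-Library.Groups_Big_Fun"
begin

text \<open>
  The expressions below are polymorphic in the base. Division is field division, so
  \<open>gauss_binom p\<close> is the Gaussian polynomial only if \<open>p\<close> is not a root of unity; the
  theorem uses transcendental bases only.
\<close>

definition q_poch :: "'a::field \<Rightarrow> 'a \<Rightarrow> nat \<Rightarrow> 'a" where
  "q_poch a p n = (\<Prod>i<n. 1 - a * p ^ i)"

definition gauss_binom :: "'a::field \<Rightarrow> int \<Rightarrow> int \<Rightarrow> 'a" where
  "gauss_binom p A B =
     (if 0 \<le> B \<and> B \<le> A
      then q_poch p p (nat A) / (q_poch p p (nat B) * q_poch p p (nat (A - B)))
      else 0)"

definition T1 :: "nat \<Rightarrow> int \<Rightarrow> 'a::field \<Rightarrow> 'a" where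
  "T1 L A q =
     (\<Sum>r=0..L. (- q) ^ r * gauss_binom (q ^ 2) (int L) (int r)
                 * gauss_binom q (2 * int L - 2 * int r) (int L - A - int r))"

text \<open>
  Unbounded sums are rendered by \<^const>\<open>Sum_any\<close>, the sum of the nonzero terms. It is \<open>0\<close> by
  convention on infinite support, a case ruled out by \<open>finite_support_P\<close> and
  \<open>finite_support_T1\<close> below.
\<close>

definition P_term :: "'a::field \<Rightarrow> nat \<Rightarrow> nat \<Rightarrow> nat \<Rightarrow> nat \<Rightarrow> 'a" where
  "P_term q n j k l =
     q ^ (j ^ 2 + j + k * (k + 1) div 2 + l)
     * gauss_binom q (int j) (int k)
     * gauss_binom (q ^ 2) (int j + int l) (int l)
     * gauss_binom q (int n - int j - int k - 2 * int l) (int j)"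

definition P :: "'a::field \<Rightarrow> nat \<Rightarrow> 'a" where
  "P q n = (\<Sum>j. \<Sum>k. \<Sum>l. P_term q n j k l)"

lemma finite_support_P: "finite {(j, k, l). P_term q n j k l \<noteq> 0}"
proof (rule finite_subset)
  show "{(j, k, l). P_term q n j k l \<noteq> 0} \<subseteq> {..n} \<times> {..n} \<times> {..n}"
    by (auto simp: P_term_def gauss_binom_def split: if_splits)
qed simp

lemma finite_support_T1: "finite {j::int. T1 L (3 * j + 1) q \<noteq> 0}"
proof (rule finite_subset)
  show "{j. T1 L (3 * j + 1) q \<noteq> 0} \<subseteq> {- int L - 1..int L}"
  proof
    fix j assume "j \<in> {j. T1 L (3 * j + 1) q \<noteq> 0}"
    then obtain r where "r \<le> L"
      "gauss_binom q (2 * int L - 2 * int r) (int L - (3 * j + 1) - int r) \<noteq> 0"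
      unfolding T1_def by (auto elim: sum.not_neutral_contains_not_neutral)
    then show "j \<in> {- int L - 1..int L}"
      by (auto simp: gauss_binom_def split: if_splits)
  qed
qed simp

text \<open>The indeterminate of the rational function field plays the role of the square root of \<open>q\<close>.\<close>

definition sqrt_q :: "rat poly fract" where
  "sqrt_q = to_fract [:0, 1:]"

definition q_ind :: "rat poly fract" where
  "q_ind = sqrt_q ^ 2"

end

theory Submission
  imports Defs
begin

text \<open>
Both sides satisfy the same third-order recurrence and agree for \<open>n = 0, 1, 2\<close>. The two
recurrences have unrelated proofs.

\<^bold>\<open>The triple sum.\<close> By the \<open>q\<close>-binomial theorem, the generating function of the inner double sum for
fixed \<open>j\<close> is
\<open>F j = q ^ (j\<^sup>2 + j) * x ^ (2 * j) * (- x * q; q)_j / ((x\<^sup>2 * q; q\<^sup>2)_(j+1) * (x; q)_(j+1))\<close>,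
so substituting \<open>x * q\<close> for \<open>x\<close> essentially turns \<open>F j\<close> into \<open>F (j + 1)\<close>:
\<open>(1 - x) * (1 - q * x\<^sup>2) * F (j + 1) = q\<^sup>2 * x\<^sup>2 * (1 + q * x) * F j (q * x)\<close> (\<open>P_series_Suc\<close>).
Summing over \<open>j\<close> gives a \<open>q\<close>-difference equation for the generating function of \<^const>\<open>P\<close>
(\<open>P_functional_eq\<close>), and comparing coefficients of \<open>x ^ n\<close> gives the recurrence (\<open>P_recurrence\<close>).
The effect of the substitution on each of the three factors is Pascal's rule for the Gaussian polynomials
that are its coefficients.

\<^bold>\<open>The bilateral sum.\<close> Next to \<^const>\<open>T1\<close> there is the \<open>q\<close>-trinomial coefficient \<open>T0\<close>, in which \<open>(- q) ^ r\<close>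
is replaced by \<open>(- 1) ^ r\<close>. Three relations of Andrews and Baxter connect them (\<open>T1_Suc\<close>, \<open>T0_Suc\<close>,
\<open>T1_diff\<close>). Write \<open>s\<close> for the square root of \<open>q\<close>, and sum these relations against the weights
\<open>(- 1) ^ j * s ^ (6 * j\<^sup>2 + c * j)\<close> at argument \<open>3 * j + a\<close>. Up to a power of \<open>s\<close> and a sign, the sum for
\<open>(a, c)\<close> equals the sum for \<open>(- a, - c)\<close>, since \<open>T0\<close> and \<open>T1\<close> are even, and the sum for
\<open>(a - 3, c - 12)\<close>, by shifting \<open>j\<close>. Hence very few sums are really different and the relations close up.
With \<open>S n\<close> the sum in the theorem for \<open>T1 n\<close> (\<open>trinomial_sum\<close>) and
\<open>V n = S (n + 1) - S n\<close> (\<open>trinomial_step\<close>), they first give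
\<open>V (n + 1) = s ^ (n + 1) * (U1 n + s\<^sup>2 * U7 n)\<close> for two sums \<open>U1\<close>, \<open>U7\<close> of values of \<open>T0\<close>
(\<open>trinomial_step_Suc\<close>). A second step leads back to \<open>V\<close> and \<open>S\<close>:
\<open>V (n + 2) = q * V n + q ^ (n + 2) * (V n + 2 * S n)\<close> (\<open>trinomial_step_Suc_Suc\<close>). Substituting the
definition of \<open>V\<close> yields the recurrence.
\<close>

section \<open>Gaussian polynomials\<close>

text \<open>
The proof works over any field. This is the condition under which the denominators in
\<^const>\<open>gauss_binom\<close> do not vanish and powers with integer exponents can be multiplied.
\<close>
definition generic :: "'a::field \<Rightarrow> bool" where
  "generic p \<longleftrightarrow> p \<noteq> 0 \<and> (\<forall>n>0. p ^ n \<noteq> 1)"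

lemma generic_power: "generic p \<Longrightarrow> n > 0 \<Longrightarrow> generic (p ^ n)"
  by (auto simp: generic_def simp flip: power_mult)

lemma generic_powi_neq_1:
  assumes "generic p" "n > 0"
  shows "p powi n \<noteq> 1"
  using assms by (auto simp: generic_def power_int_def)

lemma q_poch_Suc: "q_poch p p (Suc n) = q_poch p p n * (1 - p ^ Suc n)"
  by (simp add: q_poch_def)

lemma q_poch_nonzero:
  assumes "generic p"
  shows "q_poch p p n \<noteq> 0"
proof (induction n)
  case 0
  show ?case by (simp add: q_poch_def)
next
  case (Suc n)
  have "p ^ Suc n \<noteq> 1"
    using assms unfolding generic_def by blast
  with Suc show ?case by (simp add: q_poch_Suc del: power_Suc)
qed

lemma gauss_binom_outside: "B < 0 \<or> A < B \<Longrightarrow> gauss_binom p A B = 0"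
  by (auto simp: gauss_binom_def)

lemma gauss_binom_zero_right: "generic p \<Longrightarrow> 0 \<le> A \<Longrightarrow> gauss_binom p A 0 = 1"
  by (simp add: gauss_binom_def q_poch_nonzero) (simp add: q_poch_def)

lemma gauss_binom_diag: "generic p \<Longrightarrow> 0 \<le> A \<Longrightarrow> gauss_binom p A A = 1"
  by (simp add: gauss_binom_def q_poch_nonzero) (simp add: q_poch_def)

lemma gauss_binom_sym: "gauss_binom p A (A - B) = gauss_binom p A B"
  by (simp add: gauss_binom_def mult.commute)

text \<open>
The absorption laws hold for all integers \<open>A\<close> and \<open>B\<close>: at the boundary of the triangle one of the factors
\<open>1 - p powi A\<close>, \<open>1 - p powi B\<close> vanishes. Pascal's rule follows from them by splitting
\<open>1 - p powi A\<close>, and needs \<open>A \<noteq> 0\<close> since it fails at \<open>A = B = 0\<close>.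
\<close>
lemma gauss_binom_absorb_low:
  assumes "generic p"
  shows "(1 - p powi A) * gauss_binom p (A - 1) (B - 1) = (1 - p powi B) * gauss_binom p A B"
proof (cases "1 \<le> B \<and> B \<le> A")
  case True
  define a b where "a = nat (A - 1)" and "b = nat (B - 1)"
  have AB: "A = int (Suc a)" "B = int (Suc b)" "b \<le> a"
    using True by (auto simp: a_def b_def)
  have nat_Suc: "nat (1 + int m) = Suc m" for m by simp
  have nz: "1 - p ^ Suc b \<noteq> 0"
    using assms unfolding generic_def by (metis eq_iff_diff_eq_0 zero_less_Suc)
  have "gauss_binom p A B = q_poch p p (Suc a) / (q_poch p p (Suc b) * q_poch p p (a - b))"
    using AB by (simp add: gauss_binom_def nat_diff_distrib nat_Suc)
  moreover have "gauss_binom p (A - 1) (B - 1) = q_poch p p a / (q_poch p p b * q_poch p p (a - b))"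
    using AB by (simp add: gauss_binom_def nat_diff_distrib nat_Suc)
  moreover have "p powi A = p ^ Suc a" "p powi B = p ^ Suc b"
    using AB by (simp_all only: power_int_of_nat)
  ultimately show ?thesis
    using nz q_poch_nonzero[OF assms] by (simp add: q_poch_Suc del: power_Suc)
next
  case False
  then show ?thesis by (cases "B = 0") (auto simp: gauss_binom_def)
qed

lemma gauss_binom_absorb:
  assumes "generic p"
  shows "(1 - p powi A) * gauss_binom p (A - 1) B = (1 - p powi (A - B)) * gauss_binom p A B"
  using gauss_binom_absorb_low[OF assms, of A "A - B"]
    gauss_binom_sym[of p "A - 1" B] gauss_binom_sym[of p A B]
  by (simp add: algebra_simps)

lemma gauss_binom_ratio:
  assumes "generic p"
  shows "(1 - p powi (A - B)) * gauss_binom p A B = (1 - p powi (B + 1)) * gauss_binom p A (B + 1)"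
  using gauss_binom_absorb[OF assms, of A B] gauss_binom_absorb_low[OF assms, of A "B + 1"] by simp

lemma gauss_binom_pascal:
  assumes p: "generic p" and A: "A > 0"
  shows "gauss_binom p A B = gauss_binom p (A - 1) (B - 1) + p powi B * gauss_binom p (A - 1) B"
proof -
  have "p \<noteq> 0" using p by (simp add: generic_def)
  have split: "p powi A = p powi B * p powi (A - B)"
    using \<open>p \<noteq> 0\<close> by (simp flip: power_int_add)
  have "(1 - p powi A) * (gauss_binom p (A - 1) (B - 1) + p powi B * gauss_binom p (A - 1) B)
      = (1 - p powi B) * gauss_binom p A B + p powi B * ((1 - p powi (A - B)) * gauss_binom p A B)"
    using gauss_binom_absorb_low[OF p, of A B] gauss_binom_absorb[OF p, of A B]
    by (simp add: distrib_left mult.left_commute)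
  also have "\<dots> = (1 - p powi A) * gauss_binom p A B"
    by (simp add: split algebra_simps)
  finally show ?thesis
    using generic_powi_neq_1[OF p A] by simp
qed

lemma gauss_binom_pascal':
  assumes p: "generic p" and A: "A > 0"
  shows "gauss_binom p A B = gauss_binom p (A - 1) B + p powi (A - B) * gauss_binom p (A - 1) (B - 1)"
  using gauss_binom_pascal[OF p A, of "A - B"]
    gauss_binom_sym[of p A B] gauss_binom_sym[of p "A - 1" B] gauss_binom_sym[of p "A - 1" "B - 1"]
  by (simp add: algebra_simps)

section \<open>Summation over a row of Gaussian polynomials\<close>

text \<open>
The coefficients \<open>T0\<close> and \<open>T1\<close> are weighted sums over a row of Gaussian polynomials, and their relations
mostly fail for single terms: parts of the terms have to be moved from \<open>r\<close> to \<open>r + 1\<close>. Pascal's rule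
(twice) and absorption provide this summation by parts; no boundary terms arise, as Gaussian polynomials
vanish outside the row.
\<close>
lemma sum_gauss_pascal:
  assumes "generic p"
  shows "(\<Sum>r=0..Suc n. gauss_binom p (int (Suc n)) (int r) * f r)
       = (\<Sum>r=0..n. gauss_binom p (int n) (int r) * (p ^ r * f r + f (Suc r)))"
proof -
  have P: "gauss_binom p (int (Suc n)) (int r)
      = gauss_binom p (int n) (int r - 1) + p ^ r * gauss_binom p (int n) (int r)" for r
    using gauss_binom_pascal[OF assms, of "int (Suc n)" "int r"] by simp
  have "(\<Sum>r=0..Suc n. gauss_binom p (int (Suc n)) (int r) * f r)
      = (\<Sum>r=0..Suc n. gauss_binom p (int n) (int r - 1) * f r)
        + (\<Sum>r=0..Suc n. gauss_binom p (int n) (int r) * (p ^ r * f r))"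
    unfolding P by (simp add: sum.distrib algebra_simps)
  also have "(\<Sum>r=0..Suc n. gauss_binom p (int n) (int r - 1) * f r)
      = (\<Sum>r=0..n. gauss_binom p (int n) (int r) * f (Suc r))"
    by (subst sum.atLeast0_atMost_Suc_shift) (simp add: gauss_binom_outside)
  also have "(\<Sum>r=0..Suc n. gauss_binom p (int n) (int r) * (p ^ r * f r))
      = (\<Sum>r=0..n. gauss_binom p (int n) (int r) * (p ^ r * f r))"
    by (simp add: gauss_binom_outside)
  finally show ?thesis by (simp add: sum.distrib algebra_simps)
qed

lemma sum_gauss_pascal':
  assumes "generic p"
  shows "(\<Sum>r=0..Suc n. gauss_binom p (int (Suc n)) (int r) * f r)
       = (\<Sum>r=0..n. gauss_binom p (int n) (int r) * (f r + p powi (int n - int r) * f (Suc r)))"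
proof -
  have P: "gauss_binom p (int (Suc n)) (int r)
      = gauss_binom p (int n) (int r) + p powi (int n + 1 - int r) * gauss_binom p (int n) (int r - 1)" for r
    using gauss_binom_pascal'[OF assms, of "int (Suc n)" "int r"] by (simp add: algebra_simps)
  have "(\<Sum>r=0..Suc n. gauss_binom p (int (Suc n)) (int r) * f r)
      = (\<Sum>r=0..Suc n. gauss_binom p (int n) (int r) * f r)
        + (\<Sum>r=0..Suc n. gauss_binom p (int n) (int r - 1) * (p powi (int n + 1 - int r) * f r))"
    unfolding P by (simp add: sum.distrib algebra_simps)
  also have "(\<Sum>r=0..Suc n. gauss_binom p (int n) (int r - 1) * (p powi (int n + 1 - int r) * f r))
      = (\<Sum>r=0..n. gauss_binom p (int n) (int r) * (p powi (int n - int r) * f (Suc r)))"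
    by (subst sum.atLeast0_atMost_Suc_shift) (simp add: gauss_binom_outside)
  also have "(\<Sum>r=0..Suc n. gauss_binom p (int n) (int r) * f r)
      = (\<Sum>r=0..n. gauss_binom p (int n) (int r) * f r)"
    by (simp add: gauss_binom_outside)
  finally show ?thesis by (simp add: sum.distrib algebra_simps)
qed

lemma sum_gauss_absorb:
  assumes "generic p"
  shows "(\<Sum>r=0..n. (1 - p ^ r) * gauss_binom p (int n) (int r) * f r)
       = (\<Sum>r=0..n. (1 - p powi (int n - int r)) * gauss_binom p (int n) (int r) * f (Suc r))"
proof -
  have R: "(1 - p powi (int n - int r)) * gauss_binom p (int n) (int r)
      = (1 - p ^ Suc r) * gauss_binom p (int n) (int (Suc r))" for r
    using gauss_binom_ratio[OF assms, of "int n" "int r"]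
    by (simp add: add.commute power_int_add_1' flip: of_nat_Suc)
  have "(\<Sum>r=0..n. (1 - p ^ r) * gauss_binom p (int n) (int r) * f r)
      = (\<Sum>r=0..Suc n. (1 - p ^ r) * gauss_binom p (int n) (int r) * f r)"
    by (simp add: gauss_binom_outside)
  also have "\<dots> = (\<Sum>r=0..n. (1 - p ^ Suc r) * gauss_binom p (int n) (int (Suc r)) * f (Suc r))"
    by (subst sum.atLeast0_atMost_Suc_shift) simp
  finally show ?thesis by (simp only: R)
qed

section \<open>Relations between \<open>q\<close>-trinomial coefficients\<close>

definition T0 :: "nat \<Rightarrow> int \<Rightarrow> 'a::field \<Rightarrow> 'a" where
  "T0 L A q =
     (\<Sum>r=0..L. (- 1) ^ r * gauss_binom (q ^ 2) (int L) (int r)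
                 * gauss_binom q (2 * int L - 2 * int r) (int L - A - int r))"

lemma gauss_binom_two_step:
  assumes p: "generic p" and A: "A \<ge> 2"
  shows "gauss_binom p A B = (1 + p powi (A - 1)) * gauss_binom p (A - 2) (B - 1)
    + p powi (A - B) * gauss_binom p (A - 2) (B - 2) + p powi B * gauss_binom p (A - 2) B"
proof -
  have "p \<noteq> 0" using p by (simp add: generic_def)
  then have "p powi (A - 1) = p powi B * p powi (A - 1 - B)"
    by (simp flip: power_int_add)
  then show ?thesis
    using gauss_binom_pascal[OF p, of A B] gauss_binom_pascal'[OF p, of "A - 1" "B - 1"]
      gauss_binom_pascal'[OF p, of "A - 1" B] A
    by (simp add: algebra_simps)
qed

lemma gauss_binom_two_step':
  assumes p: "generic p" and A: "A \<ge> 2"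
  shows "gauss_binom p A B = gauss_binom p (A - 2) B
    + (p powi (A - B) + p powi (A - B - 1)) * gauss_binom p (A - 2) (B - 1)
    + (p powi (A - B))\<^sup>2 * gauss_binom p (A - 2) (B - 2)"
  using gauss_binom_pascal'[OF p, of A B] gauss_binom_pascal'[OF p, of "A - 1" "B - 1"]
    gauss_binom_pascal'[OF p, of "A - 1" B] A
  by (simp add: algebra_simps power2_eq_square)

text \<open>
With the index of the row written as \<open>L - r\<close>, the second factor becomes a central coefficient
\<open>[2 * N, N - A]\<close> with \<open>N = L - r\<close>, and the binomial in base \<open>q\<^sup>2\<close> stands in front, as required by the
row summation lemmas.
\<close>
lemma T1_alt: "T1 L A q = (\<Sum>r=0..L. gauss_binom (q ^ 2) (int L) (int r) *
     ((- q) ^ r * gauss_binom q (2 * (int L - int r)) (int L - int r - A)))"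
  unfolding T1_def by (rule sum.cong) (auto simp: algebra_simps)

lemma T0_alt: "T0 L A q = (\<Sum>r=0..L. gauss_binom (q ^ 2) (int L) (int r) *
     ((- 1) ^ r * gauss_binom q (2 * (int L - int r)) (int L - int r - A)))"
  unfolding T0_def by (rule sum.cong) (auto simp: algebra_simps)

text \<open>
Pascal's rule for the row sum produces \<open>[2 * N + 2, N + 1 - A] - q ^ (2 * N + 1) * [2 * N, N - A]\<close>, in which
the subtracted term is exactly the surplus of the two-step expansion of the first one.
\<close>
lemma T1_Suc:
  assumes q: "generic q"
  shows "T1 (Suc n) A q = T1 n A q + q powi (int n + 1 + A) * T0 n (A + 1) q
     + q powi (int n + 1 - A) * T0 n (A - 1) q"
proof -
  have q0: "q \<noteq> 0" using q by (simp add: generic_def)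
  have q2: "generic (q ^ 2)" using q by (simp add: generic_power)
  define g where "g = gauss_binom q"
  have key: "(- q) ^ r * g (2 * (int (Suc n) - int r)) (int (Suc n) - int r - A)
      + (q ^ 2) powi (int n - int r) * ((- q) ^ Suc r * g (2 * (int (Suc n) - int (Suc r))) (int (Suc n) - int (Suc r) - A))
      = (- q) ^ r * g (2 * (int n - int r)) (int n - int r - A)
      + q powi (int n + 1 + A) * ((- 1) ^ r * g (2 * (int n - int r)) (int n - int r - (A + 1)))
      + q powi (int n + 1 - A) * ((- 1) ^ r * g (2 * (int n - int r)) (int n - int r - (A - 1)))"
    if "r \<le> n" for r
  proof -
    define N where "N = int n - int r"
    have N: "N \<ge> 0" using that by (simp add: N_def)
    have n: "int n = N + int r" by (simp add: N_def)
    have sq: "(q ^ 2) powi N = q powi (2 * N)" by (simp add: power_int_power)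
    have odd: "q powi (1 + N * 2) = q * q powi (N * 2)" using q0 by (simp add: power_int_add)
    have up: "q powi (A + (1 + (N + int r))) = q ^ r * q powi (N + 1 + A)"
      using q0 by (simp flip: power_int_of_nat power_int_add add: algebra_simps)
    have down: "q powi (1 + (N + int r) - A) = q ^ r * q powi (N + 1 - A)"
      using q0 by (simp flip: power_int_of_nat power_int_add add: algebra_simps)
    have minus: "(- q) ^ r = (- 1) ^ r * q ^ r" by (rule power_minus)
    have "g (2 * N + 2) (N + 1 - A) = (1 + q * q powi (2 * N)) * g (2 * N) (N - A)
       + q powi (N + 1 + A) * g (2 * N) (N - 1 - A) + q powi (N + 1 - A) * g (2 * N) (N + 1 - A)"
      using gauss_binom_two_step[OF q, of "2 * N + 2" "N + 1 - A"] N
      by (simp add: g_def odd algebra_simps)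
    then show ?thesis
      unfolding n of_nat_Suc by (simp add: sq up down minus algebra_simps)
  qed
  show ?thesis
    unfolding T1_alt T0_alt sum_gauss_pascal'[OF q2] sum_distrib_left sum.distrib[symmetric]
    proof (rule sum.cong, goal_cases)
    case (2 r)
    then show ?case
      using arg_cong[OF key, of r "(*) (gauss_binom (q ^ 2) (int n) (int r))"]
      by (simp add: g_def algebra_simps)
  qed simp
qed

text \<open>
The identity that makes the remainder in the proof of \<open>T0_Suc\<close> cancel: Pascal's rule collapses the
left-hand side to one coefficient in row \<open>2 * N - 1\<close>, which absorption lifts to row \<open>2 * N\<close>.
\<close>
lemma gauss_binom_central_cancel:
  assumes q: "generic q" and N: "N \<ge> 0"
  shows "(1 - q powi (2 * N)) * (gauss_binom q (2 * N - 2) (N - A)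
           + q powi (N + A - 1) * gauss_binom q (2 * N - 2) (N - A - 1))
       = (1 - q powi (N + A)) * gauss_binom q (2 * N) (N - A)"
proof (cases "N = 0")
  case True
  then show ?thesis by (cases "A = 0") (auto simp: gauss_binom_def)
next
  case False
  with N have "gauss_binom q (2 * N - 1) (N - A) = gauss_binom q (2 * N - 2) (N - A)
           + q powi (N + A - 1) * gauss_binom q (2 * N - 2) (N - A - 1)"
    using gauss_binom_pascal'[OF q, of "2 * N - 1" "N - A"] by (simp add: algebra_simps)
  then show ?thesis
    using gauss_binom_absorb[OF q, of "2 * N" "N - A"] by (simp add: algebra_simps)
qed

text \<open>
Unlike for \<open>T1_Suc\<close>, Pascal's rule and the two-step expansion leave a remainder \<open>D r\<close> that does not vanish for a
single \<open>r\<close>. Its part with the factor \<open>1 - q ^ (2 * r)\<close> is moved from \<open>r\<close> to \<open>r + 1\<close> by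
\<open>sum_gauss_absorb\<close>, and then each term is zero.
\<close>
lemma T0_Suc:
  assumes q: "generic q"
  shows "T0 (Suc n) A q = T0 n (A - 1) q + q powi (int n + 1 + A) * T1 n A q
     + (q powi (int n + 1 + A))\<^sup>2 * T0 n (A + 1) q"
proof -
  have q0: "q \<noteq> 0" using q by (simp add: generic_def)
  have q2: "generic (q ^ 2)" using q by (simp add: generic_power)
  define g where "g = gauss_binom q"
  define b where "b r = gauss_binom (q ^ 2) (int n) (int r)" for r
  define G where "G r = g (2 * (int n - int r)) (int n - int r - A)" for r
  define h where "h r = (- 1) ^ r * (g (2 * (int n - int r)) (int n - int r + 1 - A)
      + q powi (int n - int r + A) * G r)" for r
  define D where "D r = - (1 - (q ^ 2) ^ r) * h r - (- 1) ^ r * (1 - q powi (int n - int r + A)) * G r" for r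
  have key: "(q ^ 2) ^ r * ((- 1) ^ r * g (2 * (int (Suc n) - int r)) (int (Suc n) - int r - A))
      + (- 1) ^ Suc r * g (2 * (int (Suc n) - int (Suc r))) (int (Suc n) - int (Suc r) - A)
      = (- 1) ^ r * g (2 * (int n - int r)) (int n - int r - (A - 1))
      + q powi (int n + 1 + A) * ((- q) ^ r * G r)
      + (q powi (int n + 1 + A))\<^sup>2 * ((- 1) ^ r * g (2 * (int n - int r)) (int n - int r - (A + 1)))
      + D r"
    if "r \<le> n" for r
  proof -
    define N where "N = int n - int r"
    have N: "N \<ge> 0" using that by (simp add: N_def)
    have n: "int n = N + int r" by (simp add: N_def)
    define x where "x = q powi (A + N)"
    have x1: "q powi (1 + (N + A)) = q * x" using q0 by (simp add: x_def power_int_add)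
    have up: "q powi (A + (1 + (N + int r))) = q ^ r * (q * x)"
      using q0 by (simp add: x_def flip: power_int_of_nat power_int_add power_int_add_1') (simp add: algebra_simps)
    have minus: "(- q) ^ r = (- 1) ^ r * q ^ r" by (rule power_minus)
    have "g (2 * N + 2) (N + 1 - A) = g (2 * N) (N + 1 - A) + (q * x + x) * g (2 * N) (N - A)
       + (q * x)\<^sup>2 * g (2 * N) (N - 1 - A)"
      using gauss_binom_two_step'[OF q, of "2 * N + 2" "N + 1 - A"] N
      by (simp add: g_def algebra_simps flip: x1) (simp add: x_def algebra_simps)
    then show ?thesis
      unfolding D_def h_def G_def n of_nat_Suc
      by (simp add: up minus algebra_simps power2_eq_square power_mult_distrib flip: x_def)
  qed
  have cancel: "- (1 - (q ^ 2) powi (int n - int r)) * h (Suc r)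
      - (- 1) ^ r * (1 - q powi (int n - int r + A)) * G r = 0" if "r \<le> n" for r
  proof -
    define N where "N = int n - int r"
    have N: "N \<ge> 0" using that by (simp add: N_def)
    have n: "int n = N + int r" by (simp add: N_def)
    have sq: "(q ^ 2) powi N = q powi (2 * N)" by (simp add: power_int_power)
    show ?thesis
      using arg_cong[OF gauss_binom_central_cancel[OF q N, of A], of "(*) ((- 1) ^ r)"]
      unfolding h_def G_def g_def n of_nat_Suc
      by (simp add: sq algebra_simps)
  qed
  have "(\<Sum>r=0..n. b r * D r)
      = - (\<Sum>r=0..n. (1 - (q ^ 2) ^ r) * b r * h r)
        - (\<Sum>r=0..n. (- 1) ^ r * (1 - q powi (int n - int r + A)) * b r * G r)"
    unfolding sum_negf[symmetric] sum_subtractf[symmetric]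
    by (rule sum.cong) (simp_all add: D_def algebra_simps)
  also have "\<dots> = (\<Sum>r=0..n. b r * (- (1 - (q ^ 2) powi (int n - int r)) * h (Suc r)
      - (- 1) ^ r * (1 - q powi (int n - int r + A)) * G r))"
    unfolding b_def sum_gauss_absorb[OF q2] sum_negf[symmetric] sum_subtractf[symmetric]
    by (rule sum.cong) (simp_all add: algebra_simps)
  also have "\<dots> = 0"
    using cancel by (intro sum.neutral) auto
  finally have D0: "(\<Sum>r=0..n. b r * D r) = 0" .
  have "T0 (Suc n) A q = T0 n (A - 1) q + q powi (int n + 1 + A) * T1 n A q
     + (q powi (int n + 1 + A))\<^sup>2 * T0 n (A + 1) q + (\<Sum>r=0..n. b r * D r)"
    unfolding T1_alt T0_alt sum_gauss_pascal[OF q2] sum_distrib_left sum.distrib[symmetric]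
    proof (rule sum.cong, goal_cases)
    case (2 r)
    then show ?case
      using arg_cong[OF key, of r "(*) (gauss_binom (q ^ 2) (int n) (int r))"]
      by (simp add: g_def b_def G_def algebra_simps)
  qed simp
  with D0 show ?thesis by simp
qed

text \<open>
This holds term by term: after collecting powers of \<open>q\<close>, it is the ratio of two neighbouring entries in row
\<open>2 * N\<close>.
\<close>
lemma T1_diff:
  assumes q: "generic q"
  shows "T1 n A q - T1 n (A + 1) q
    = q powi (int n - A) * T0 n A q - q powi (int n + A + 1) * T0 n (A + 1) q"
proof -
  have q0: "q \<noteq> 0" using q by (simp add: generic_def)
  define g where "g = gauss_binom q"
  have key: "(- q) ^ r * g (2 * (int n - int r)) (int n - int r - A)
      - (- q) ^ r * g (2 * (int n - int r)) (int n - int r - (A + 1))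
      = q powi (int n - A) * ((- 1) ^ r * g (2 * (int n - int r)) (int n - int r - A))
      - q powi (int n + A + 1) * ((- 1) ^ r * g (2 * (int n - int r)) (int n - int r - (A + 1)))" for r
  proof -
    define N where "N = int n - int r"
    have n: "int n = N + int r" by (simp add: N_def)
    have up: "q powi (A + (1 + (N + int r))) = q ^ r * q powi (N + A + 1)"
      using q0 by (simp flip: power_int_of_nat power_int_add add: algebra_simps)
    have down: "q powi (N + int r - A) = q ^ r * q powi (N - A)"
      using q0 by (simp flip: power_int_of_nat power_int_add add: algebra_simps)
    have minus: "(- q) ^ r = (- 1) ^ r * q ^ r" by (rule power_minus)
    have "(1 - q powi (N + A + 1)) * g (2 * N) (N - (A + 1)) = (1 - q powi (N - A)) * g (2 * N) (N - A)"
      using gauss_binom_ratio[OF q, of "2 * N" "N - (A + 1)"] by (simp add: g_def algebra_simps)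
    then have "(- q) ^ r * ((1 - q powi (N + A + 1)) * g (2 * N) (N - (A + 1)))
         = (- q) ^ r * ((1 - q powi (N - A)) * g (2 * N) (N - A))" by simp
    then show ?thesis
      unfolding n by (simp add: up down minus algebra_simps)
  qed
  show ?thesis
    unfolding T1_alt T0_alt sum_distrib_left sum_subtractf[symmetric]
    proof (rule sum.cong, goal_cases)
    case (2 r)
    then show ?case
      using arg_cong[OF key[of r], of "(*) (gauss_binom (q ^ 2) (int n) (int r))"]
      by (simp add: g_def algebra_simps)
  qed simp
qed

lemma T1_uminus: "T1 n (- A) q = T1 n A q"
  unfolding T1_alt
proof (rule sum.cong)
  fix r
  show "gauss_binom (q ^ 2) (int n) (int r) *
      ((- q) ^ r * gauss_binom q (2 * (int n - int r)) (int n - int r - - A)) =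
    gauss_binom (q ^ 2) (int n) (int r) *
      ((- q) ^ r * gauss_binom q (2 * (int n - int r)) (int n - int r - A))"
    using gauss_binom_sym[of q "2 * (int n - int r)" "int n - int r - A"] by (simp add: algebra_simps)
qed simp

lemma T0_uminus: "T0 n (- A) q = T0 n A q"
  unfolding T0_alt
proof (rule sum.cong)
  fix r
  show "gauss_binom (q ^ 2) (int n) (int r) *
      ((- 1) ^ r * gauss_binom q (2 * (int n - int r)) (int n - int r - - A)) =
    gauss_binom (q ^ 2) (int n) (int r) *
      ((- 1) ^ r * gauss_binom q (2 * (int n - int r)) (int n - int r - A))"
    using gauss_binom_sym[of q "2 * (int n - int r)" "int n - int r - A"] by (simp add: algebra_simps)
qed simp

lemma T1_outside: "\<bar>A\<bar> > int n \<Longrightarrow> T1 n A q = 0"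
  unfolding T1_alt by (intro sum.neutral) (auto simp: gauss_binom_def)

lemma T0_outside: "\<bar>A\<bar> > int n \<Longrightarrow> T0 n A q = 0"
  unfolding T0_alt by (intro sum.neutral) (auto simp: gauss_binom_def)

section \<open>Bilateral sums over a residue class modulo 3\<close>

text \<open>
The exponent is chosen so that all sums occurring in the proof are of this form. Shifting \<open>j\<close> by one moves
\<open>a\<close> by 3 and \<open>c\<close> by 12, and a factor \<open>s powi A\<close> inside \<open>f A\<close> moves \<open>c\<close> by 3.
\<close>
definition theta :: "'a::field \<Rightarrow> (int \<Rightarrow> 'a) \<Rightarrow> int \<Rightarrow> int \<Rightarrow> 'a" where
  "theta s f a c = (\<Sum>j. (- 1) powi j * s powi (6 * j ^ 2 + c * j) * f (3 * j + a))"

definition finsupp :: "(int \<Rightarrow> 'a::zero) \<Rightarrow> bool" where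
  "finsupp f \<longleftrightarrow> finite {A. f A \<noteq> 0}"

lemma finsupp_add:
  "finsupp f \<Longrightarrow> finsupp g \<Longrightarrow> finsupp (\<lambda>A. f A + g A :: 'a::ab_group_add)"
  unfolding finsupp_def by (rule finite_subset[of _ "{A. f A \<noteq> 0} \<union> {A. g A \<noteq> 0}"]) auto

lemma finsupp_mult: "finsupp f \<Longrightarrow> finsupp (\<lambda>A. k A * f A :: 'a::field)"
  unfolding finsupp_def by (rule finite_subset[of _ "{A. f A \<noteq> 0}"]) auto

lemma finsupp_translate: "finsupp f \<Longrightarrow> finsupp (\<lambda>A. f (A + d))"
  unfolding finsupp_def
  using finite_vimageI[of "{A. f A \<noteq> 0}" "\<lambda>A. A + d"] by (simp add: inj_def vimage_def)

lemma finsupp_T: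
  "finsupp (\<lambda>A. T0 n A q)" "finsupp (\<lambda>A. T1 n A q)"
proof -
  have "A \<in> {- int n..int n}" if "T0 n A q \<noteq> 0 \<or> T1 n A q \<noteq> 0" for A
  proof (rule ccontr)
    assume "A \<notin> {- int n..int n}"
    then have "\<bar>A\<bar> > int n" by auto
    with that show False by (simp add: T0_outside T1_outside)
  qed
  then have "{A. T0 n A q \<noteq> 0} \<subseteq> {- int n..int n}" "{A. T1 n A q \<noteq> 0} \<subseteq> {- int n..int n}"
    by blast+
  then show "finsupp (\<lambda>A. T0 n A q)" "finsupp (\<lambda>A. T1 n A q)"
    unfolding finsupp_def by (auto intro: finite_subset)
qed

lemma finite_theta_support:
  assumes "finsupp f"
  shows "finite {j. k j * f (3 * j + a) \<noteq> (0::'a::field)}"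
proof (rule finite_subset)
  show "{j. k j * f (3 * j + a) \<noteq> 0} \<subseteq> (\<lambda>j. 3 * j + a) -` {A. f A \<noteq> 0}" by auto
  show "finite ((\<lambda>j. 3 * j + a) -` {A. f A \<noteq> 0})"
    using assms by (intro finite_vimageI) (auto simp: finsupp_def inj_def)
qed

lemma theta_add:
  assumes "finsupp f" "finsupp g"
  shows "theta s (\<lambda>A. f A + g A) a c = theta s f a c + theta s g a c"
  unfolding theta_def distrib_left
  by (rule Sum_any.distrib) (intro finite_theta_support assms)+

lemma theta_cmult:
  assumes "finsupp f"
  shows "theta s (\<lambda>A. k * f A) a c = k * theta s f a c"
  unfolding theta_def Sum_any_right_distrib[OF finite_theta_support[OF assms]]
  by (simp add: mult_ac cong: Sum_any.cong)

lemma theta_powi: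
  assumes "finsupp f" "s \<noteq> 0"
  shows "theta s (\<lambda>A. s powi (k * A) * f A) a c = s powi (k * a) * theta s f a (c + 3 * k)"
proof -
  have *: "s powi (6 * j ^ 2 + c * j) * s powi (k * (3 * j + a)) = s powi (k * a) * s powi (6 * j ^ 2 + (c + 3 * k) * j)"
    for j using assms(2) by (simp add: algebra_simps flip: power_int_add)
  have "(- 1) powi j * s powi (6 * j ^ 2 + c * j) * (s powi (k * (3 * j + a)) * f (3 * j + a))
     = s powi (k * a) * ((- 1) powi j * s powi (6 * j ^ 2 + (c + 3 * k) * j) * f (3 * j + a))" for j
    using arg_cong[OF *[of j], of "\<lambda>x. (- 1) powi j * f (3 * j + a) * x"] by (simp only: mult_ac)
  then show ?thesis
    unfolding theta_def Sum_any_right_distrib[OF finite_theta_support[OF assms(1)]]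
    by (rule Sum_any.cong)
qed

lemma theta_translate: "theta s (\<lambda>A. f (A + d)) a c = theta s f (a + d) c"
  unfolding theta_def by (simp add: add.assoc)

lemma theta_shift:
  assumes "finsupp f" "s \<noteq> 0"
  shows "theta s f a c = - (s powi (6 - c)) * theta s f (a - 3) (c - 12)"
proof -
  have *: "s powi (6 * (j - 1)\<^sup>2 + c * (j - 1)) = s powi (6 - c) * s powi (6 * j ^ 2 + (c - 12) * j)" for j
    using assms(2) by (simp add: algebra_simps power2_eq_square flip: power_int_add)
  have m: "(- 1 :: 'a) powi (j - 1) = - ((- 1) powi j)" for j
    by (simp add: power_int_diff)
  have "theta s f a c = (\<Sum>j. - (s powi (6 - c)) * ((- 1) powi j * s powi (6 * j ^ 2 + (c - 12) * j) * f (3 * j + (a - 3))))"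
    unfolding theta_def
  proof (rule Sum_any.reindex_cong)
    show "bij (\<lambda>j::int. j - 1)" by (rule bij_betw_byWitness[of _ "\<lambda>j. j + 1"]) auto
    have "(- 1) powi (j - 1) * s powi (6 * (j - 1)\<^sup>2 + c * (j - 1)) * f (3 * (j - 1) + a)
      = - (s powi (6 - c)) * ((- 1) powi j * s powi (6 * j ^ 2 + (c - 12) * j) * f (3 * j + (a - 3)))" for j
      unfolding * m by (simp add: algebra_simps)
    then show "(\<lambda>j. (- 1) powi j * s powi (6 * j\<^sup>2 + c * j) * f (3 * j + a)) \<circ> (\<lambda>j. j - 1) =
      (\<lambda>j. - (s powi (6 - c)) * ((- 1) powi j * s powi (6 * j ^ 2 + (c - 12) * j) * f (3 * j + (a - 3))))"
      by (simp only: fun_eq_iff comp_def) simp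
  qed
  then show ?thesis
    unfolding theta_def Sum_any_right_distrib[OF finite_theta_support[OF assms(1)]] .
qed

lemma theta_reflect:
  assumes "\<And>A. f (- A) = f A"
  shows "theta s f (- a) (- c) = theta s f a c"
  unfolding theta_def
proof (rule Sum_any.reindex_cong)
  show "bij (uminus :: int \<Rightarrow> int)" by (rule bij_betw_byWitness[of _ uminus]) auto
  have "(- 1) powi (- j) * s powi (6 * (- j)\<^sup>2 + - c * (- j)) * f (3 * (- j) + - a)
      = (- 1) powi j * s powi (6 * j\<^sup>2 + c * j) * f (3 * j + a)" for j :: int
    using assms[of "3 * j + a"] by (simp add: power_int_minus_one_minus)
  then show "(\<lambda>j. (- 1) powi j * s powi (6 * j\<^sup>2 + - c * j) * f (3 * j + - a)) \<circ> uminus =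
    (\<lambda>j. (- 1) powi j * s powi (6 * j\<^sup>2 + c * j) * f (3 * j + a))"
    by (simp only: fun_eq_iff comp_def) simp
qed

section \<open>The recurrence for the bilateral sum\<close>

definition theta0 :: "'a::field \<Rightarrow> nat \<Rightarrow> int \<Rightarrow> int \<Rightarrow> 'a" where
  "theta0 s n = theta s (\<lambda>A. T0 n A s)"

definition theta1 :: "'a::field \<Rightarrow> nat \<Rightarrow> int \<Rightarrow> int \<Rightarrow> 'a" where
  "theta1 s n = theta s (\<lambda>A. T1 n A s)"

lemma theta_weighted:
  assumes "finsupp f" "s \<noteq> 0"
  shows "theta s (\<lambda>A. u * (s powi (k * A) * f (A + d))) a c = u * (s powi (k * a) * theta s f (a + d) (c + 3 * k))"
  using assms by (simp add: theta_cmult theta_powi theta_translate finsupp_mult finsupp_translate)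

text \<open>
The form in which a three-term relation between trinomial coefficients is transferred to the sums.
\<close>
lemma theta_combination:
  assumes "finsupp f" "finsupp g" "finsupp h" "s \<noteq> 0"
  shows "theta s (\<lambda>A. u * (s powi (k * A) * f (A + d)) + v * (s powi (l * A) * g (A + e))
             + w * (s powi (m * A) * h (A + i))) a c
       = u * (s powi (k * a) * theta s f (a + d) (c + 3 * k))
       + v * (s powi (l * a) * theta s g (a + e) (c + 3 * l))
       + w * (s powi (m * a) * theta s h (a + i) (c + 3 * m))"
proof -
  have fin: "finsupp (\<lambda>A. u * (s powi (k * A) * F (A + d)))" if "finsupp F" for F u k d
    using that by (intro finsupp_mult finsupp_translate)
  show ?thesis
    by (simp only: theta_add finsupp_add fin assms theta_weighted[OF assms(1,4)]
        theta_weighted[OF assms(2,4)] theta_weighted[OF assms(3,4)])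
qed

lemma theta1_Suc:
  assumes "generic s"
  shows "theta1 s (Suc n) a c = theta1 s n a c
    + s ^ n * s powi (1 + a) * theta0 s n (a + 1) (c + 3)
    + s ^ n * s powi (1 - a) * theta0 s n (a - 1) (c - 3)"
proof -
  have s: "s \<noteq> 0" using assms by (simp add: generic_def)
  have eq: "T1 (Suc n) A s = 1 * (s powi (0 * A) * T1 n (A + 0) s)
      + s ^ Suc n * (s powi (1 * A) * T0 n (A + 1) s)
      + s ^ Suc n * (s powi (- 1 * A) * T0 n (A + - 1) s)" for A
    using s by (simp add: T1_Suc[OF assms] power_int_add power_int_diff power_int_minus divide_simps)
  show ?thesis
    unfolding theta1_def theta0_def eq theta_combination[OF finsupp_T(2) finsupp_T(1) finsupp_T(1) s]
    using s by (simp add: power_int_add power_int_diff power_int_minus divide_simps)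
qed

lemma theta0_Suc:
  assumes "generic s"
  shows "theta0 s (Suc n) a c = theta0 s n (a - 1) c
    + s ^ n * s powi (1 + a) * theta1 s n a (c + 3)
    + (s ^ n * s powi (1 + a))\<^sup>2 * theta0 s n (a + 1) (c + 6)"
proof -
  have s: "s \<noteq> 0" using assms by (simp add: generic_def)
  have sq: "s powi (2 * A) = (s powi A)\<^sup>2" for A
    using s by (simp add: power2_eq_square flip: power_int_add)
  have eq: "T0 (Suc n) A s = 1 * (s powi (0 * A) * T0 n (A + - 1) s)
      + s ^ Suc n * (s powi (1 * A) * T1 n (A + 0) s)
      + (s ^ Suc n)\<^sup>2 * (s powi (2 * A) * T0 n (A + 1) s)" for A
    unfolding sq using s by (simp add: T0_Suc[OF assms] power_int_add power_mult_distrib)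
  show ?thesis
    unfolding theta1_def theta0_def eq theta_combination[OF finsupp_T(1) finsupp_T(2) finsupp_T(1) s]
    using s by (simp add: sq power_int_add power_mult_distrib)
qed

lemma theta1_diff:
  assumes "generic s"
  shows "theta1 s n a c - theta1 s n (a + 1) c
    = s ^ n * s powi (- a) * theta0 s n a (c - 3)
    - s ^ n * s powi (1 + a) * theta0 s n (a + 1) (c + 3)"
proof -
  have s: "s \<noteq> 0" using assms by (simp add: generic_def)
  have eq: "T1 n (A + 1) s = 1 * (s powi (0 * A) * T1 n (A + 0) s)
      + - (s ^ n) * (s powi (- 1 * A) * T0 n (A + 0) s)
      + s ^ Suc n * (s powi (1 * A) * T0 n (A + 1) s)" for A
    using s T1_diff[OF assms, of n A]
    by (simp add: power_int_add power_int_diff power_int_minus field_simps)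
  have "theta1 s n (a + 1) c = theta s (\<lambda>A. T1 n (A + 1) s) a c"
    unfolding theta1_def by (rule theta_translate[symmetric])
  then show ?thesis
    unfolding theta1_def theta0_def eq theta_combination[OF finsupp_T(2) finsupp_T(1) finsupp_T(1) s]
    using s by (simp add: power_int_add power_int_minus)
qed

lemma theta0_reflect: "theta0 s n (- a) (- c) = theta0 s n a c"
  unfolding theta0_def by (rule theta_reflect) (rule T0_uminus)

lemma theta1_reflect: "theta1 s n (- a) (- c) = theta1 s n a c"
  unfolding theta1_def by (rule theta_reflect) (rule T1_uminus)

lemma theta0_shift: "s \<noteq> 0 \<Longrightarrow> theta0 s n a c = - (s powi (6 - c)) * theta0 s n (a - 3) (c - 12)"
  unfolding theta0_def by (rule theta_shift[OF finsupp_T(1)])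

definition trinomial_sum :: "'a::field \<Rightarrow> nat \<Rightarrow> 'a" where
  "trinomial_sum s n = theta1 s n 1 4"

text \<open>
The increment of \<^const>\<open>trinomial_sum\<close>, written in terms of \<^const>\<open>T0\<close> only; the factor
\<open>s ^ n\<close> is the common power produced by \<open>theta1_Suc\<close>.
\<close>
definition trinomial_step :: "'a::field \<Rightarrow> nat \<Rightarrow> 'a" where
  "trinomial_step s n = s ^ n * (theta0 s n 0 1 - s * theta0 s n 1 5)"

context
  fixes s :: "'a::field"
  assumes s: "generic s"
begin

lemma s_nonzero: "s \<noteq> 0" using s by (simp add: generic_def)

text \<open>
Of the sums with \<open>a = 0\<close> or \<open>a = 1\<close>, the following rules bring every other pair of parameters that arises back
to \<open>(0, 1)\<close>, \<open>(1, 1)\<close>, \<open>(1, 5)\<close> or \<open>(1, 7)\<close>.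
\<close>
lemma theta0_0_minus1: "theta0 s n 0 (- 1) = theta0 s n 0 1"
  using theta0_reflect[of s n 0 1] by simp

lemma theta0_2_7: "theta0 s n 2 7 = - inverse s * theta0 s n 1 5"
  using theta0_shift[OF s_nonzero, of n 2 7] theta0_reflect[of s n 1 5] by (simp add: power_int_minus)

lemma theta0_2_5: "theta0 s n 2 5 = - s * theta0 s n 1 7"
  using theta0_shift[OF s_nonzero, of n 2 5] theta0_reflect[of s n 1 7] by simp

lemma trinomial_sum_Suc: "trinomial_sum s (Suc n) = trinomial_sum s n + trinomial_step s n"
  using theta1_Suc[OF s, of n 1 4] s_nonzero
  by (simp add: trinomial_sum_def trinomial_step_def theta0_2_7 field_simps power2_eq_square)

lemma trinomial_step_alt: "trinomial_step s n = theta1 s n 0 2 - theta1 s n 1 2"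
  using theta1_diff[OF s, of n 0 2] by (simp add: trinomial_step_def theta0_0_minus1 algebra_simps)

text \<open>
For each of the four parameter pairs, one chooses the representative to which \<open>theta0_Suc\<close> is applied. The
choices \<open>(0, - 1)\<close>, \<open>(- 1, - 5)\<close>, \<open>(1, 1)\<close> and \<open>(- 1, - 7)\<close> are those for which only the same four
sums, \<^const>\<open>trinomial_sum\<close>, and the two sums in \<open>trinomial_step_alt\<close> appear.
\<close>
lemma theta0_Suc_0_1: "theta0 s (Suc n) 0 1
    = theta0 s n 1 1 + s ^ Suc n * theta1 s n 0 2 + (s ^ Suc n)\<^sup>2 * theta0 s n 1 5"
  using theta0_Suc[OF s, of n 0 "- 1"] theta0_0_minus1[of "Suc n"] theta0_reflect[of s n 1 1]
  by (simp add: mult_ac)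

lemma theta0_Suc_1_5: "theta0 s (Suc n) 1 5
    = - s * theta0 s n 1 7 + s ^ n * theta1 s n 1 2 + (s ^ n)\<^sup>2 * theta0 s n 0 1"
  using theta0_Suc[OF s, of n "- 1" "- 5"] theta0_reflect[of s "Suc n" 1 5] theta0_reflect[of s n 2 5]
    theta1_reflect[of s n 1 2] by (simp add: theta0_2_5)

lemma theta0_Suc_1_1: "theta0 s (Suc n) 1 1
    = theta0 s n 0 1 + s ^ n * s\<^sup>2 * trinomial_sum s n - (s ^ n)\<^sup>2 * s ^ 3 * theta0 s n 1 5"
  using theta0_Suc[OF s, of n 1 1] s_nonzero
  by (simp add: theta0_2_7 trinomial_sum_def field_simps power2_eq_square power3_eq_cube)

lemma theta0_Suc_1_7: "theta0 s (Suc n) 1 7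
    = - inverse s * theta0 s n 1 5 + s ^ n * trinomial_sum s n + (s ^ n)\<^sup>2 * theta0 s n 0 1"
  using theta0_Suc[OF s, of n "- 1" "- 7"] theta0_reflect[of s "Suc n" 1 7] theta0_reflect[of s n 2 7]
    theta1_reflect[of s n 1 4] by (simp add: theta0_2_7 theta0_0_minus1 trinomial_sum_def)

text \<open>
Two representations of the step meet here. The terms with \<^const>\<open>theta1\<close> form the step at \<open>n\<close> by
\<open>trinomial_step_alt\<close>, and the terms with the highest power of \<open>s\<close> form its negative by definition, so
both disappear.
\<close>
lemma trinomial_step_Suc: "trinomial_step s (Suc n) = s ^ Suc n * (theta0 s n 1 1 + s\<^sup>2 * theta0 s n 1 7)"
proof -
  have "trinomial_step s (Suc n) = s ^ Suc n * (theta0 s n 1 1 + s\<^sup>2 * theta0 s n 1 7)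
      + (s ^ Suc n)\<^sup>2 * ((theta1 s n 0 2 - theta1 s n 1 2) - trinomial_step s n)"
    unfolding trinomial_step_def[of s "Suc n"] theta0_Suc_0_1 theta0_Suc_1_5 trinomial_step_def[of s n]
    by (simp add: algebra_simps power2_eq_square)
  then show ?thesis by (simp add: trinomial_step_alt)
qed

text \<open>
In the combination of \<open>theta0_Suc_1_1\<close> and \<open>theta0_Suc_1_7\<close> demanded by \<open>trinomial_step_Suc\<close>, the sums of
\<^const>\<open>T0\<close> come only as \<open>theta0 s n 0 1 - s * theta0 s n 1 5\<close>, that is, as the step at \<open>n\<close>.
\<close>
lemma trinomial_step_Suc_Suc:
  "trinomial_step s (Suc (Suc n)) = s\<^sup>2 * trinomial_step s n
    + s ^ (2 * n + 4) * (trinomial_step s n + 2 * trinomial_sum s n)"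
proof -
  have "s\<^sup>2 * theta0 s (Suc n) 1 7 = - s * theta0 s n 1 5 + s\<^sup>2 * (s ^ n * trinomial_sum s n + (s ^ n)\<^sup>2 * theta0 s n 0 1)"
    unfolding theta0_Suc_1_7 using s_nonzero by (simp add: field_simps power2_eq_square)
  note shifted = this
  show ?thesis
    unfolding trinomial_step_Suc[of "Suc n"] shifted theta0_Suc_1_1 trinomial_step_def[of s n]
    by (simp add: power_add power_mult algebra_simps power2_eq_square power4_eq_xxxx power3_eq_cube power_mult_distrib)
qed

lemma trinomial_sum_recurrence:
  assumes "n \<ge> 2"
  shows "trinomial_sum s (n + 1) = trinomial_sum s n + (s\<^sup>2 + (s\<^sup>2) ^ n) * trinomial_sum s (n - 1) + ((s\<^sup>2) ^ n - s\<^sup>2) * trinomial_sum s (n - 2)"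
proof -
  obtain m where n: "n = Suc (Suc m)" using assms by (metis add_2_eq_Suc le_Suc_ex)
  have V: "trinomial_step s k = trinomial_sum s (Suc k) - trinomial_sum s k" for k by (simp add: trinomial_sum_Suc)
  have "2 * m + 4 = 2 * n" by (simp add: n)
  then have p: "s ^ (2 * m + 4) = (s\<^sup>2) ^ n" by (simp only: power_mult)
  show ?thesis
    using trinomial_step_Suc_Suc[of m] unfolding p unfolding V by (simp add: n algebra_simps del: power_Suc)
qed

lemma theta_zero:
  "theta1 s 0 1 c = 0" "theta0 s 0 1 c = 0"
proof -
  have "T1 0 (3 * j + 1) s = 0" "T0 0 (3 * j + 1) s = 0" for j
    by (rule T1_outside, presburger) (rule T0_outside, presburger)
  then show "theta1 s 0 1 c = 0" "theta0 s 0 1 c = 0"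
    by (simp_all add: theta1_def theta0_def theta_def)
qed

lemma trinomial_sum_initial: "trinomial_sum s 0 = 0" "trinomial_sum s 1 = 1" "trinomial_sum s 2 = 1"
proof -
  show S0: "trinomial_sum s 0 = 0" by (simp add: trinomial_sum_def theta_zero)
  have T: "T0 0 (3 * j) s = (if j = 0 then 1 else 0)" for j
    by (auto simp: T0_alt gauss_binom_def q_poch_def)
  have "theta0 s 0 0 1 = (\<Sum>j::int. if j = 0 then 1 else 0)"
    unfolding theta0_def theta_def by (rule Sum_any.cong) (simp add: T)
  then have "trinomial_step s 0 = 1" by (simp add: trinomial_step_def theta_zero)
  then show S1: "trinomial_sum s 1 = 1" using trinomial_sum_Suc[of 0] S0 by simp
  show "trinomial_sum s 2 = 1"
    using trinomial_sum_Suc[of 1] trinomial_step_Suc[of 0] S1 by (simp add: theta_zero numeral_2_eq_2)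
qed

end

section \<open>The recurrence for the triple sum\<close>

text \<open>
The substitution of \<open>q * x\<close> for \<open>x\<close>.
\<close>
definition dilate :: "'a::field \<Rightarrow> 'a fps \<Rightarrow> 'a fps" where
  "dilate q f = Abs_fps (\<lambda>n. q ^ n * fps_nth f n)"

lemma dilate_nth [simp]: "fps_nth (dilate q f) n = q ^ n * fps_nth f n"
  by (simp add: dilate_def)

lemma dilate_mult: "dilate q (f * g) = dilate q f * dilate q g"
proof (rule fps_ext)
  fix n
  have "q ^ n = q ^ i * q ^ (n - i)" if "i \<le> n" for i
    using that by (simp flip: power_add)
  then show "fps_nth (dilate q (f * g)) n = fps_nth (dilate q f * dilate q g) n"
    by (simp add: fps_mult_nth sum_distrib_left mult_ac)
qed

lemma dilate_const: "dilate q (fps_const c) = fps_const c"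
  by (rule fps_ext) simp

lemma dilate_X_power: "dilate q (fps_X ^ j) = fps_const (q ^ j) * fps_X ^ j"
  by (rule fps_ext) simp

text \<open>
The generating functions of the three Gaussian polynomials in \<^const>\<open>P_term\<close>. In closed form they are
\<open>(- x * q; q)_j\<close>, \<open>1 / (x\<^sup>2 * q; q\<^sup>2)_(j+1)\<close> and \<open>x ^ j / (x; q)_(j+1)\<close>. The second one is a series in \<open>x\<^sup>2\<close>
because \<open>l\<close> contributes \<open>2 * l\<close> to the index \<open>n\<close>; the index \<open>m\<close> of the third one is the upper
index of the last Gaussian polynomial.
\<close>
definition k_series :: "'a::field \<Rightarrow> nat \<Rightarrow> 'a fps" where
  "k_series q j = Abs_fps (\<lambda>k. q ^ (k * (k + 1) div 2) * gauss_binom q (int j) (int k))"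

definition l_series :: "'a::field \<Rightarrow> nat \<Rightarrow> 'a fps" where
  "l_series q j = Abs_fps (\<lambda>i. if even i
     then q ^ (i div 2) * gauss_binom (q ^ 2) (int j + int (i div 2)) (int (i div 2)) else 0)"

definition m_series :: "'a::field \<Rightarrow> nat \<Rightarrow> 'a fps" where
  "m_series q j = Abs_fps (\<lambda>m. gauss_binom q (int m) (int j))"

definition P_series :: "'a::field \<Rightarrow> nat \<Rightarrow> 'a fps" where
  "P_series q j = fps_const (q ^ (j ^ 2 + j)) * (k_series q j * (l_series q j * (fps_X ^ j * m_series q j)))"

lemma k_series_Suc:
  assumes q: "generic q"
  shows "k_series q (Suc j) = (1 + fps_const q * fps_X) * dilate q (k_series q j)"
proof (rule fps_ext)
  fix k
  show "fps_nth (k_series q (Suc j)) k = fps_nth ((1 + fps_const q * fps_X) * dilate q (k_series q j)) k"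
  proof (cases k)
    case 0
    then show ?thesis using q by (simp add: k_series_def gauss_binom_zero_right distrib_right mult.assoc)
  next
    case (Suc i)
    have "k * (k + 1) div 2 = k + i * (i + 1) div 2" unfolding Suc by simp
    moreover have "q powi (1 + int i) = q * q ^ i"
      by (metis of_nat_Suc power_int_of_nat power_Suc)
    ultimately show ?thesis
      using gauss_binom_pascal[OF q, of "int (Suc j)" "int k"]
      by (simp add: k_series_def Suc distrib_right mult.assoc algebra_simps power_add)
  qed
qed

lemma l_series_Suc:
  assumes q: "generic q"
  shows "(1 - fps_const q * fps_X ^ 2) * l_series q (Suc j) = dilate q (l_series q j)"
proof (rule fps_ext)
  fix i
  have q2: "generic (q ^ 2)" using q by (simp add: generic_power)
  consider "odd i" | "i = 0" | l where "i = 2 * Suc l"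
    by (metis evenE not0_implies_Suc mult_0_right)
  then show "fps_nth ((1 - fps_const q * fps_X ^ 2) * l_series q (Suc j)) i = fps_nth (dilate q (l_series q j)) i"
  proof cases
    case 1
    then show ?thesis by (simp add: l_series_def left_diff_distrib mult.assoc fps_X_power_mult_nth)
  next
    case 2
    then show ?thesis using q2
      by (simp add: l_series_def left_diff_distrib mult.assoc fps_X_power_mult_nth gauss_binom_zero_right)
  next
    case 3
    have "gauss_binom (q ^ 2) (int (Suc j) + int (Suc l)) (int (Suc l))
       = gauss_binom (q ^ 2) (int (Suc j) + int l) (int l) + (q ^ 2) ^ Suc l * gauss_binom (q ^ 2) (int j + int (Suc l)) (int (Suc l))"
    proof -
      have "int (Suc j) + int (Suc l) - 1 = int j + int (Suc l)" "int (Suc l) - 1 = int l" by simp_all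
      moreover have "int j + int (Suc l) = int (Suc j) + int l" by simp
      ultimately show ?thesis
        using gauss_binom_pascal[OF q2, of "int (Suc j) + int (Suc l)" "int (Suc l)"]
        by (simp only: power_int_of_nat)
    qed
    then show ?thesis
      unfolding 3 by (simp add: l_series_def left_diff_distrib mult.assoc fps_X_power_mult_nth)
        (simp add: algebra_simps power_mult power2_eq_square)
  qed
qed

text \<open>
The factor \<open>q ^ j\<close> avoids a negative power of \<open>q\<close>. It is what the substitution produces from
\<open>x ^ j\<close> in \<open>P_series_Suc\<close>.
\<close>
lemma m_series_Suc:
  assumes q: "generic q"
  shows "fps_const (q ^ j) * ((1 - fps_X) * m_series q (Suc j)) = fps_X * dilate q (m_series q j)"
proof (rule fps_ext)
  fix m
  show "fps_nth (fps_const (q ^ j) * ((1 - fps_X) * m_series q (Suc j))) m = fps_nth (fps_X * dilate q (m_series q j)) m"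
  proof (cases m)
    case 0
    then show ?thesis by (simp add: m_series_def left_diff_distrib gauss_binom_outside)
  next
    case (Suc i)
    have "q ^ j * q powi (int i - int j) = q ^ i"
      using q by (simp add: generic_def flip: power_int_of_nat power_int_add)
    then show ?thesis
      using gauss_binom_pascal'[OF q, of "int (Suc i)" "int (Suc j)"]
      by (simp add: m_series_def left_diff_distrib Suc flip: mult.assoc)
  qed
qed

lemma P_series_Suc:
  assumes q: "generic q"
  shows "(1 - fps_X) * (1 - fps_const q * fps_X ^ 2) * P_series q (Suc j)
       = fps_const (q ^ 2) * fps_X ^ 2 * (1 + fps_const q * fps_X) * dilate q (P_series q j)"
proof -
  define c where "c = fps_const (q ^ ((Suc j) ^ 2 + 1))"
  have c: "fps_const (q ^ ((Suc j) ^ 2 + Suc j)) = c * fps_const (q ^ j)"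
    unfolding c_def fps_const_mult power_add[symmetric] by simp
  have c': "fps_const (q ^ 2) * fps_const (q ^ (j ^ 2 + j)) * fps_const (q ^ j) = c"
    unfolding c_def fps_const_mult power_add[symmetric] by (simp add: power2_eq_square algebra_simps)
  have "(1 - fps_X) * (1 - fps_const q * fps_X ^ 2) * P_series q (Suc j)
      = c * k_series q (Suc j) * ((1 - fps_const q * fps_X ^ 2) * l_series q (Suc j)) * fps_X ^ Suc j
        * (fps_const (q ^ j) * ((1 - fps_X) * m_series q (Suc j)))"
    unfolding P_series_def c by (simp only: mult_ac)
  also have "\<dots> = c * ((1 + fps_const q * fps_X) * dilate q (k_series q j)) * dilate q (l_series q j)
        * fps_X ^ Suc j * (fps_X * dilate q (m_series q j))"
    by (simp only: k_series_Suc[OF q] l_series_Suc[OF q] m_series_Suc[OF q])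
  also have "\<dots> = fps_const (q ^ 2) * fps_X ^ 2 * (1 + fps_const q * fps_X) * dilate q (P_series q j)"
    unfolding P_series_def dilate_mult dilate_const dilate_X_power c'[symmetric]
    by (simp only: power_Suc power2_eq_square mult_ac)
  finally show ?thesis .
qed

lemma P_series_0:
  assumes q: "generic q"
  shows "(1 - fps_X) * (1 - fps_const q * fps_X ^ 2) * P_series q 0 = 1"
proof -
  have q2: "generic (q ^ 2)" using q by (simp add: generic_power)
  have A: "k_series q 0 = 1"
    by (rule fps_ext) (simp add: k_series_def gauss_binom_def q_poch_def)
  have B: "(1 - fps_const q * fps_X ^ 2) * l_series q 0 = 1"
  proof (rule fps_ext)
    fix i
    consider "odd i" | "i = 0" | l where "i = 2 * Suc l"
      by (metis evenE not0_implies_Suc mult_0_right)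
    then show "fps_nth ((1 - fps_const q * fps_X ^ 2) * l_series q 0) i = fps_nth 1 i"
      by cases (auto simp: l_series_def left_diff_distrib mult.assoc fps_X_power_mult_nth gauss_binom_diag[OF q2]
          simp flip: of_nat_Suc elim: oddE)
  qed
  have C: "(1 - fps_X) * m_series q 0 = 1"
  proof (rule fps_ext)
    fix m
    show "fps_nth ((1 - fps_X) * m_series q 0) m = fps_nth 1 m"
      by (cases m) (auto simp: m_series_def left_diff_distrib gauss_binom_zero_right[OF q] simp flip: of_nat_Suc)
  qed
  have "(1 - fps_X) * (1 - fps_const q * fps_X ^ 2) * P_series q 0
     = k_series q 0 * ((1 - fps_const q * fps_X ^ 2) * l_series q 0) * ((1 - fps_X) * m_series q 0)"
    unfolding P_series_def by simp
  then show ?thesis by (simp add: A B C)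
qed

lemma P_series_nth_eq_0: "n < j \<Longrightarrow> fps_nth (P_series q j) n = 0"
proof -
  have "P_series q j = fps_X ^ j * (fps_const (q ^ (j ^ 2 + j)) * (k_series q j * (l_series q j * m_series q j)))"
    by (simp only: P_series_def mult_ac)
  then show "n < j \<Longrightarrow> fps_nth (P_series q j) n = 0"
    by (simp add: fps_X_power_mult_nth)
qed

lemma even_fps_mult_nth:
  fixes f g :: "'a::field fps"
  assumes "\<And>i. odd i \<Longrightarrow> fps_nth f i = 0"
  shows "fps_nth (f * g) n = (\<Sum>l\<in>{l. 2 * l \<le> n}. fps_nth f (2 * l) * fps_nth g (n - 2 * l))"
proof -
  have "fps_nth (f * g) n = (\<Sum>i\<in>{i. i \<le> n \<and> even i}. fps_nth f i * fps_nth g (n - i))"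
    unfolding fps_mult_nth by (rule sum.mono_neutral_right) (auto simp: assms)
  also have "\<dots> = (\<Sum>l\<in>{l. 2 * l \<le> n}. fps_nth f (2 * l) * fps_nth g (n - 2 * l))"
    by (rule sum.reindex_bij_witness[of _ "\<lambda>l. 2 * l" "\<lambda>i. i div 2"]) auto
  finally show ?thesis .
qed

text \<open>
The factor \<open>x ^ j\<close> together with the convolutions shifts the upper index of the last Gaussian polynomial to
\<open>n - j - k - 2 * l\<close>; where this would be negative, \<^const>\<open>gauss_binom\<close> is zero.
\<close>
lemma P_series_nth:
  fixes q :: "'a::field"
  shows "fps_nth (P_series q j) n = (\<Sum>k. \<Sum>l. P_term q n j k l)"
proof -
  have supp: "j \<le> n \<and> k \<le> n \<and> 2 * l \<le> n - k" if "P_term q n j k l \<noteq> 0" for k l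
    using that by (auto simp: P_term_def gauss_binom_def split: if_splits)
  have inner: "(\<Sum>l. P_term q n j k l) = (\<Sum>l\<in>{l. 2 * l \<le> n - k}. P_term q n j k l)" for k
    by (rule Sum_any.expand_superset)
      (use supp in \<open>auto intro: finite_subset[of _ "{..n}"]\<close>)
  have outer: "(\<Sum>k. \<Sum>l. P_term q n j k l) = (\<Sum>k=0..n. \<Sum>l. P_term q n j k l)"
  proof (rule Sum_any.expand_superset)
    show "{k. (\<Sum>l. P_term q n j k l) \<noteq> 0} \<subseteq> {0..n}"
      using supp by (auto elim!: Sum_any.not_neutral_obtains_not_neutral)
  qed simp
  have "fps_nth (fps_X ^ j * m_series q j) m = gauss_binom q (int m - int j) (int j)" for m
    by (auto simp: fps_X_power_mult_nth m_series_def gauss_binom_outside of_nat_diff)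
  then have "fps_nth (l_series q j * (fps_X ^ j * m_series q j)) m
     = (\<Sum>l\<in>{l. 2 * l \<le> m}. q ^ l * gauss_binom (q ^ 2) (int j + int l) (int l) * gauss_binom q (int (m - 2 * l) - int j) (int j))" for m
    by (subst even_fps_mult_nth) (auto simp: l_series_def)
  then have "fps_nth (P_series q j) n = (\<Sum>k=0..n. \<Sum>l\<in>{l. 2 * l \<le> n - k}. P_term q n j k l)"
    unfolding P_series_def fps_mult_left_const_nth fps_mult_nth[of "k_series q j"] sum_distrib_left
    by (intro sum.cong refl) (auto simp: k_series_def P_term_def of_nat_diff power_add sum_distrib_left algebra_simps)
  then show ?thesis unfolding outer unfolding inner .
qed

lemma P_eq_sum:
  assumes "n \<le> N"
  shows "P q n = (\<Sum>j\<le>N. fps_nth (P_series q j) n)"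
  unfolding P_def P_series_nth[symmetric]
proof (rule Sum_any.expand_superset)
  have "j \<le> N" if "fps_nth (P_series q j) n \<noteq> 0" for j
    using that assms P_series_nth_eq_0[of n j q] by linarith
  then show "{j. fps_nth (P_series q j) n \<noteq> 0} \<subseteq> {..N}" by auto
qed simp

text \<open>
Each coefficient involves only finitely many \<open>j\<close>, so the sum over \<open>j\<close> is truncated. The truncation on the
left is longer by one term because \<open>P_series_Suc\<close> raises \<open>j\<close>; the terms beyond \<open>n\<close> do not affect the
coefficient of \<open>x ^ n\<close>.
\<close>
lemma P_functional_eq:
  assumes q: "generic q"
  shows "(1 - fps_X) * (1 - fps_const q * fps_X ^ 2) * Abs_fps (P q)
       = 1 + fps_const (q ^ 2) * fps_X ^ 2 * (1 + fps_const q * fps_X) * dilate q (Abs_fps (P q))"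
  (is "?E * ?F = 1 + ?R * dilate q ?F")
proof (rule fps_ext)
  fix n
  have dil: "dilate q (\<Sum>j\<le>n. P_series q j) = (\<Sum>j\<le>n. dilate q (P_series q j))"
    by (rule fps_ext) (simp add: fps_sum_nth sum_distrib_left)
  have "?E * (\<Sum>j\<le>Suc n. P_series q j) = ?E * P_series q 0 + (\<Sum>j\<le>n. ?E * P_series q (Suc j))"
    by (simp add: sum.atMost_Suc_shift sum_distrib_left distrib_left del: sum.atMost_Suc)
  also have "\<dots> = 1 + ?R * dilate q (\<Sum>j\<le>n. P_series q j)"
    unfolding P_series_0[OF q] P_series_Suc[OF q] dil sum_distrib_left ..
  finally have eq: "?E * (\<Sum>j\<le>Suc n. P_series q j) = 1 + ?R * dilate q (\<Sum>j\<le>n. P_series q j)" .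
  have "fps_nth (?E * ?F) n = fps_nth (?E * (\<Sum>j\<le>Suc n. P_series q j)) n"
    unfolding fps_mult_nth[of ?E] by (intro sum.cong refl) (simp add: fps_sum_nth P_eq_sum[of _ "Suc n"] del: sum.atMost_Suc)
  moreover have "fps_nth (?R * dilate q ?F) n = fps_nth (?R * dilate q (\<Sum>j\<le>n. P_series q j)) n"
    unfolding fps_mult_nth[of ?R] by (intro sum.cong refl) (simp add: fps_sum_nth P_eq_sum[of _ n])
  ultimately show "fps_nth (?E * ?F) n = fps_nth (1 + ?R * dilate q ?F) n"
    by (simp only: eq fps_add_nth)
qed

lemma P_recurrence:
  assumes q: "generic q"
  shows "P q 0 = 1" "P q 1 = 1" "P q 2 = q ^ 2 + q + 1"
    "n \<ge> 3 \<Longrightarrow> P q n = P q (n - 1) + (q + q ^ n) * P q (n - 2) + (q ^ n - q) * P q (n - 3)"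
proof -
  define F where "F = Abs_fps (P q)"
  have F: "F = 1 + fps_X * F + fps_const q * (fps_X ^ 2 * F) - fps_const q * (fps_X ^ 3 * F)
      + fps_const (q ^ 2) * (fps_X ^ 2 * dilate q F) + fps_const (q ^ 3) * (fps_X ^ 3 * dilate q F)"
  proof -
    define c where "c = fps_const q"
    have c: "fps_const (q ^ 2) = c ^ 2" "fps_const (q ^ 3) = c ^ 3"
      by (simp_all add: c_def fps_const_power)
    show ?thesis
      using P_functional_eq[OF q] unfolding F_def[symmetric] c c_def[symmetric]
      by (simp add: algebra_simps power2_eq_square power3_eq_cube)
  qed
  have nth: "P q n = (if n = 0 then 1 else 0) + (if n = 0 then 0 else P q (n - 1))
      + q * (if n < 2 then 0 else P q (n - 2)) - q * (if n < 3 then 0 else P q (n - 3))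
      + q ^ 2 * (if n < 2 then 0 else q ^ (n - 2) * P q (n - 2))
      + q ^ 3 * (if n < 3 then 0 else q ^ (n - 3) * P q (n - 3))" for n
    using arg_cong[OF F, of "\<lambda>f. fps_nth f n"]
    by (simp add: F_def fps_X_power_mult_nth del: One_nat_def)
  show P0: "P q 0 = 1" using nth[of 0] by simp
  show P1: "P q 1 = 1" using nth[of 1] P0 by simp
  show "P q 2 = q ^ 2 + q + 1" using nth[of 2] P0 P1 by (simp add: algebra_simps)
  assume n: "n \<ge> 3"
  have "2 + (n - 2) = n" "3 + (n - 3) = n" using n by auto
  then have e: "q ^ 2 * (q ^ (n - 2) * x) = q ^ n * x" "q ^ 3 * (q ^ (n - 3) * x) = q ^ n * x" for x
    by (metis power_add mult.assoc)+
  have "P q n = P q (n - 1) + q * P q (n - 2) - q * P q (n - 3) + q ^ n * P q (n - 2) + q ^ n * P q (n - 3)"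
    using nth[of n] n by (simp add: e)
  then show "P q n = P q (n - 1) + (q + q ^ n) * P q (n - 2) + (q ^ n - q) * P q (n - 3)"
    by (simp add: algebra_simps)
qed

section \<open>The identity\<close>

lemma P_eq_trinomial_sum:
  assumes s: "generic s"
  shows "P (s\<^sup>2) n = trinomial_sum s (n + 1)"
proof (induction n rule: less_induct)
  case (less n)
  have q: "generic (s\<^sup>2)" using s by (simp add: generic_power)
  note init = P_recurrence(1-3)[OF q] trinomial_sum_initial[OF s]
  consider "n = 0" | "n = 1" | "n = 2" | "n \<ge> 3" by linarith
  then show ?case
  proof cases
    case 1
    then show ?thesis using init by simp
  next
    case 2
    then show ?thesis by (simp only: one_add_one init)
  next
    case 3
    \<comment> \<open>Here the recurrence reaches back to \<open>trinomial_sum s 0 = 0\<close>, which would be \<open>P\<close> at \<open>- 1\<close>.\<close>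
    then show ?thesis
      using trinomial_sum_recurrence[OF s, of 2] init by (simp add: algebra_simps)
  next
    case 4
    have "n - 1 < n" "n - 2 < n" "n - 3 < n" "n - 1 + 1 = n" "n - 2 + 1 = n - 1" "n - 3 + 1 = n - 2"
      using 4 by auto
    then have IH: "P (s\<^sup>2) (n - 1) = trinomial_sum s n" "P (s\<^sup>2) (n - 2) = trinomial_sum s (n - 1)"
        "P (s\<^sup>2) (n - 3) = trinomial_sum s (n - 2)"
      using less.IH by metis+
    have "n \<ge> 2" using 4 by simp
    show ?thesis
      unfolding P_recurrence(4)[OF q 4] trinomial_sum_recurrence[OF s \<open>n \<ge> 2\<close>] IH ..
  qed
qed

lemma trinomial_sum_eq_T1_sum:
  fixes s :: "'a::field"
  shows "trinomial_sum s n = (\<Sum>j::int. (- 1) powi j * (s\<^sup>2) powi (3 * j ^ 2 + 2 * j) * T1 n (3 * j + 1) s)"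
proof -
  have "(s\<^sup>2) powi (3 * j ^ 2 + 2 * j) = s powi (6 * j ^ 2 + 4 * j)" for j
    by (simp add: power_int_power algebra_simps)
  then show ?thesis
    by (simp add: trinomial_sum_def theta1_def theta_def)
qed

lemma generic_sqrt_q: "generic sqrt_q"
proof -
  have "sqrt_q ^ n \<noteq> 1" if "n > 0" for n
  proof
    assume "sqrt_q ^ n = 1"
    moreover have "to_fract (p ^ n) = to_fract p ^ n" for p :: "rat poly"
      by (induction n) simp_all
    ultimately have "to_fract ([:0, 1:] ^ n :: rat poly) = to_fract 1"
      by (simp add: sqrt_q_def)
    then have "([:0, 1:] :: rat poly) ^ n = 1" by (simp only: to_fract_eq_iff)
    then have "poly (([:0, 1:] :: rat poly) ^ n) 0 = 1" by simp
    with that show False by (simp add: power_0_left)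
  qed
  moreover have "sqrt_q \<noteq> 0" by (simp add: sqrt_q_def)
  ultimately show ?thesis by (simp add: generic_def)
qed

theorem mainTheorem7:
  shows "(\<forall>n. P q_ind n =
            (\<Sum>j::int. (- 1) powi j * q_ind powi (3 * j ^ 2 + 2 * j) * T1 (n + 1) (3 * j + 1) sqrt_q))
       \<and> P q_ind 0 = 1
       \<and> P q_ind 1 = 1
       \<and> P q_ind 2 = q_ind ^ 2 + q_ind + 1
       \<and> (\<forall>n\<ge>3. P q_ind n = P q_ind (n - 1) + (q_ind + q_ind ^ n) * P q_ind (n - 2)
                            + (q_ind ^ n - q_ind) * P q_ind (n - 3))"
proof -
  have q: "generic q_ind"
    using generic_power[OF generic_sqrt_q, of 2] by (simp add: q_ind_def)
  show ?thesis
    using P_recurrence[OF q] P_eq_trinomial_sum[OF generic_sqrt_q, folded q_ind_def]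
      trinomial_sum_eq_T1_sum[of sqrt_q, folded q_ind_def]
    by metis
qed

end
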